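(* Let $d\ge 1$ be an integer and let $q=(q_1,\dots,q_{d+1}): I\to(\mathbb{R}^d)^{d+1}$ be a zero angular momentum solution, on an interval $I\subset\mathbb{R}$, of Newton's equations with the attractive gravitational ($1/r$) potential for $d+1$ bodies with positive masses $m_1,\dots,m_{d+1}$ in $\mathbb{R}^d$. Suppose there is a constant $c>0$ such that $r_{ab}(t)\le c$ for all pairs $a\ne b$ and all $t\in I$. Then every closed time interval contained in $I$ of length $\pi\left(\frac{c^3}{GM}\right)^{1/2}$ contains a degeneration instant of the solution.
   Context: $G>0$ is the gravitational constant, $M=\sum_a m_a$ is the total mass, and $r_{ab}=|q_a-q_b|$. Newton's equations are $m_a\ddot q_a=-\partial V/\partial q_a$, $a=1,\dots,d+1$, with $V(q)=-G\sum_{a<b}m_am_b/r_{ab}$. A solution on $I$ is a curve satisfying these equations and having all $r_{ab}(t)>0$ for $t\in I$. Angular momentum is taken in the center-of-mass frame: with $q_{cm}=\frac1M\sum_a m_aq_a$, zero angular momentum means $\sum_a m_a(q_a-q_{cm})\wedge(\dot q_a-\dot q_{cm})=0$. A degeneration instant is a time $t$ at which all $d+1$ points $q_1(t),\dots,q_{d+1}(t)$ lie on a single affine hyperplane of $\mathbb{R}^d$. *)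

theory Defs
  imports "HOL-Analysis.Analysis"
begin

text \<open>
  A configuration of \<open>N\<close> bodies in \<open>real ^ 'd\<close> is a map \<open>nat \<Rightarrow> real ^ 'd\<close>, of which only the
  values at the indices \<open>1, \<dots>, N\<close> matter; likewise for the masses.
\<close>

definition total_mass :: "nat \<Rightarrow> (nat \<Rightarrow> real) \<Rightarrow> real" where
  "total_mass N m = (\<Sum>a=1..N. m a)"

definition potential ::
    "real \<Rightarrow> nat \<Rightarrow> (nat \<Rightarrow> real) \<Rightarrow> (nat \<Rightarrow> real ^ 'd) \<Rightarrow> real" where
  "potential G N m x = - G * (\<Sum>a=1..N. \<Sum>b\<in>{a<..N}. m a * m b / dist (x a) (x b))"

text \<open>Derivatives are taken within the time interval \<open>I\<close>, hence one-sided at an endpoint of \<open>I\<close>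
  belonging to \<open>I\<close>.\<close>

definition velocity ::
    "real set \<Rightarrow> (real \<Rightarrow> nat \<Rightarrow> real ^ 'd) \<Rightarrow> real \<Rightarrow> nat \<Rightarrow> real ^ 'd" where
  "velocity I q t a = vector_derivative (\<lambda>s. q s a) (at t within I)"

definition acceleration ::
    "real set \<Rightarrow> (real \<Rightarrow> nat \<Rightarrow> real ^ 'd) \<Rightarrow> real \<Rightarrow> nat \<Rightarrow> real ^ 'd" where
  "acceleration I q t a = vector_derivative (\<lambda>s. velocity I q s a) (at t within I)"

text \<open>The last conjunct is Newton's equation: the partial gradient of the potential with respect to
  the position of body \<open>a\<close> exists and equals minus mass times acceleration.\<close>

definition newton_solution ::
    "real \<Rightarrow> nat \<Rightarrow> (nat \<Rightarrow> real) \<Rightarrow> real set \<Rightarrow> (real \<Rightarrow> nat \<Rightarrow> real ^ 'd) \<Rightarrow> bool" where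
  "newton_solution G N m I q \<longleftrightarrow>
     (\<forall>t\<in>I.
        (\<forall>a\<in>{1..N}. \<forall>b\<in>{1..N}. a \<noteq> b \<longrightarrow> dist (q t a) (q t b) > 0) \<and>
        (\<forall>a\<in>{1..N}.
           (\<lambda>s. q s a) differentiable (at t within I) \<and>
           (\<lambda>s. velocity I q s a) differentiable (at t within I) \<and>
           GDERIV (\<lambda>y. potential G N m ((q t)(a := y))) (q t a)
             :> - (m a *\<^sub>R acceleration I q t a)))"

definition center_of_mass ::
    "nat \<Rightarrow> (nat \<Rightarrow> real) \<Rightarrow> (nat \<Rightarrow> real ^ 'd) \<Rightarrow> real ^ 'd" where
  "center_of_mass N m x = (1 / total_mass N m) *\<^sub>R (\<Sum>a=1..N. m a *\<^sub>R x a)"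

text \<open>Bivectors are identified with skew-symmetric matrices.\<close>

definition wedge :: "real ^ 'd \<Rightarrow> real ^ 'd \<Rightarrow> real ^ 'd ^ 'd" where
  "wedge x y = (\<chi> i j. x $ i * y $ j - x $ j * y $ i)"

definition angular_momentum ::
    "nat \<Rightarrow> (nat \<Rightarrow> real) \<Rightarrow> real set \<Rightarrow> (real \<Rightarrow> nat \<Rightarrow> real ^ 'd) \<Rightarrow> real \<Rightarrow> real ^ 'd ^ 'd" where
  "angular_momentum N m I q t =
     (\<Sum>a=1..N. m a *\<^sub>R wedge (q t a - center_of_mass N m (q t))
        (velocity I q t a
          - vector_derivative (\<lambda>s. center_of_mass N m (q s)) (at t within I)))"

definition degeneration_instant :: "nat \<Rightarrow> (real \<Rightarrow> nat \<Rightarrow> real ^ 'd) \<Rightarrow> real \<Rightarrow> bool" where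
  "degeneration_instant N q t \<longleftrightarrow>
     (\<exists>H. affine H \<and> aff_dim H = int CARD('d) - 1 \<and> (\<forall>a\<in>{1..N}. q t a \<in> H))"

end

theory Submission
  imports Defs
begin

text \<open>
  Suppose the configuration stays nondegenerate on a closed interval \<open>[u, v]\<close> of length
  \<open>\<pi> / \<omega>\<close>, where \<open>\<omega>\<^sup>2 = k = GM / c\<^sup>3\<close>. A positive function \<open>\<phi>\<close> with \<open>\<phi>'' \<le> - k \<phi>\<close> on
  this interval contradicts Sturm comparison with \<open>sin (\<omega> (t - u))\<close>, so it is enough to produce
  such a \<open>\<phi>\<close>.

  Write \<open>Q\<^sub>a\<close> for the positions relative to the center of mass and let \<open>X\<close> be the linear map
  \<open>\<xi> \<mapsto> \<Sum> \<xi>\<^sub>a Q\<^sub>a\<close> on weights \<open>\<xi>\<close> with \<open>\<Sum> \<xi>\<^sub>a = 0\<close>, normed by \<open>\<Sum> \<xi>\<^sub>a\<^sup>2 / m\<^sub>a\<close>. For \<open>d + 1\<close>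
  bodies in \<open>d\<close>-space, nondegeneracy means that \<open>X\<close> is invertible. Its smallest singular
  value measures the distance from degeneracy, and it is the minimum over unit vectors \<open>x\<close> of
  \<open>1 / \<bar>X\<^sup>-\<^sup>1 x\<bar>\<close>. A minimum of smooth functions need not be smooth, but no minimum has to be
  taken: for each fixed \<open>x \<noteq> 0\<close> the function \<open>\<phi> = 1 / \<bar>X\<^sup>-\<^sup>1 x\<bar>\<close> already satisfies the
  differential inequality.

  To avoid choosing coordinates on the space of weights, put \<open>(X\<^sup>-\<^sup>1 x)\<^sub>a = m\<^sub>a (p \<bullet> Q\<^sub>a)\<close>, where
  \<open>p\<close> solves \<open>B p = x\<close> for the inertia tensor \<open>B p = \<Sum> m\<^sub>a (p \<bullet> Q\<^sub>a) Q\<^sub>a\<close>. With \<open>V = Q'\<close> and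
  \<open>W = Q''\<close> let
  \<open>f = \<Sum> m\<^sub>a (p \<bullet> Q\<^sub>a)\<^sup>2\<close>, \<open>g = \<Sum> m\<^sub>a (p \<bullet> Q\<^sub>a) (p \<bullet> V\<^sub>a)\<close> and \<open>K = \<Sum> m\<^sub>a (p \<bullet> V\<^sub>a)\<^sup>2\<close>, so that
  \<open>\<phi> = 1 / sqrt f\<close>. Zero angular momentum is the symmetry
  \<open>\<Sum> m\<^sub>a (p \<bullet> Q\<^sub>a) V\<^sub>a = \<Sum> m\<^sub>a (p \<bullet> V\<^sub>a) Q\<^sub>a\<close> (\<open>wedge_sum_zero_pairing\<close>). Differentiating
  \<open>B p = x\<close> and using this symmetry gives \<open>\<Sum> m\<^sub>a (p' \<bullet> Q\<^sub>a + 2 (p \<bullet> V\<^sub>a)) Q\<^sub>a = 0\<close>, and injectivity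
  of \<open>X\<close> turns this into \<open>p' \<bullet> Q\<^sub>a = - 2 (p \<bullet> V\<^sub>a)\<close> for each body. Hence
  \<open>f' = - 2 g\<close> and \<open>g' = - 3 K + \<Sum> m\<^sub>a (p \<bullet> Q\<^sub>a) (p \<bullet> W\<^sub>a)\<close>. The last sum is at most \<open>- k f\<close>
  because all distances are at most \<open>c\<close> (\<open>newton_force_bound\<close>), and \<open>g\<^sup>2 \<le> f K\<close> by
  Cauchy-Schwarz. Therefore
  \<open>\<phi>'' = g' / f\<^bsup>3/2\<^esup> + 3 g\<^sup>2 / f\<^bsup>5/2\<^esup> \<le> - k \<phi>\<close> (\<open>barrier_exists\<close>).
\<close>

section \<open>Sturm comparison on a half period\<close>

text \<open>
  The Wronskian \<open>h\<close> of \<open>\<phi>\<close> and \<open>sin (\<omega> (t - u))\<close> has derivative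
  \<open>(\<phi>'' + \<omega>\<^sup>2 \<phi>) sin (\<omega> (t - u))\<close>, which is nonpositive on one half period, while its boundary
  values are \<open>- \<omega> \<phi>(u)\<close> and \<open>\<omega> \<phi>(v)\<close>.
\<close>

lemma Sturm_half_period:
  fixes \<phi> \<phi>' \<phi>'' :: "real \<Rightarrow> real"
  assumes "\<omega> > 0" and len: "v - u = pi / \<omega>"
    and d1: "\<And>t. t \<in> {u..v} \<Longrightarrow> (\<phi> has_real_derivative \<phi>' t) (at t within {u..v})"
    and d2: "\<And>t. t \<in> {u..v} \<Longrightarrow> (\<phi>' has_real_derivative \<phi>'' t) (at t within {u..v})"
    and ineq: "\<And>t. t \<in> {u..v} \<Longrightarrow> \<phi>'' t \<le> - \<omega>\<^sup>2 * \<phi> t"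
  shows "\<phi> u + \<phi> v \<le> 0"
proof -
  define h where "h t = \<phi>' t * sin (\<omega> * (t - u)) - \<phi> t * \<omega> * cos (\<omega> * (t - u))" for t
  define h' where "h' t = (\<phi>'' t + \<omega>\<^sup>2 * \<phi> t) * sin (\<omega> * (t - u))" for t
  have "pi / \<omega> > 0" using \<open>\<omega> > 0\<close> by simp
  then have "u < v" using len by linarith
  have "(h has_real_derivative h' t) (at t within {u..v})" if "t \<in> {u..v}" for t
    unfolding h_def h'_def
    by (rule derivative_eq_intros d1[OF that] d2[OF that] refl)+
      (simp add: algebra_simps power2_eq_square)
  then obtain s where s: "s \<in> {u..v}" "h v - h u = h' s * (v - u)"
    using mvt_very_simple[of u v h "\<lambda>t. (*) (h' t)"] \<open>u < v\<close>
    by (auto simp: has_field_derivative_def)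
  have "\<omega> * (s - u) \<le> pi"
    using mult_left_mono[of "s - u" "v - u" \<omega>] s(1) len \<open>\<omega> > 0\<close> by simp
  then have "sin (\<omega> * (s - u)) \<ge> 0"
    using s(1) \<open>\<omega> > 0\<close> by (intro sin_ge_zero) auto
  then have "h' s \<le> 0"
    unfolding h'_def using ineq[OF s(1)] by (intro mult_nonpos_nonneg) auto
  then have "h v \<le> h u"
    using s(2) \<open>u < v\<close> mult_nonpos_nonneg[of "h' s" "v - u"] by simp
  moreover have "h u = - (\<omega> * \<phi> u)" by (simp add: h_def)
  moreover have "h v = \<omega> * \<phi> v" using len \<open>\<omega> > 0\<close> by (simp add: h_def)
  ultimately have "\<omega> * (\<phi> u + \<phi> v) \<le> 0" by (simp add: distrib_left)
  with \<open>\<omega> > 0\<close> show ?thesis by (simp add: mult_le_0_iff)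
qed

section \<open>Differentiable systems of linear equations\<close>

lemma differentiable_prod:
  fixes f :: "'i \<Rightarrow> 'a::real_normed_vector \<Rightarrow> real"
  assumes "\<And>i. i \<in> J \<Longrightarrow> f i differentiable (at x within S)"
  shows "(\<lambda>x. \<Prod>i\<in>J. f i x) differentiable (at x within S)"
proof -
  obtain f' where "\<And>i. i \<in> J \<Longrightarrow> (f i has_derivative f' i) (at x within S)"
    using assms unfolding differentiable_def by metis
  then show ?thesis unfolding differentiable_def by (blast intro: has_derivative_prod)
qed

lemma differentiable_det:
  fixes A :: "'a::real_normed_vector \<Rightarrow> real ^ 'n ^ 'n"
  assumes "\<And>i j. (\<lambda>x. A x $ i $ j) differentiable (at x within S)"
  shows "(\<lambda>x. det (A x)) differentiable (at x within S)"
  unfolding det_def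
  using assms
  by (intro differentiable_sum ballI differentiable_mult differentiable_prod differentiable_const)
    (auto simp: finite_permutations)

text \<open>
  Cramer's rule expresses the solution as a quotient of determinants, so its differentiability
  is inherited from the entries of the matrix.
\<close>

lemma differentiable_linear_system:
  fixes A :: "real \<Rightarrow> real ^ 'n ^ 'n" and b :: "real ^ 'n"
  assumes A: "\<And>t i j. t \<in> S \<Longrightarrow> (\<lambda>t. A t $ i $ j) differentiable (at t within S)"
    and inj: "\<And>t p. t \<in> S \<Longrightarrow> A t *v p = 0 \<Longrightarrow> p = 0"
  obtains p where "\<And>t. t \<in> S \<Longrightarrow> A t *v p t = b"
    and "\<And>t. t \<in> S \<Longrightarrow> p differentiable (at t within S)"
proof -
  define D where "D k t = det (\<chi> i j. if j = k then b $ i else A t $ i $ j)" for k t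
  define p :: "real \<Rightarrow> real ^ 'n" where "p t = (\<chi> k. D k t / det (A t))" for t
  have det: "det (A t) \<noteq> 0" if "t \<in> S" for t
  proof -
    have "\<forall>p. A t *v p = 0 \<longrightarrow> p = 0" using inj[OF that] by blast
    then show ?thesis
      unfolding invertible_det_nz[symmetric] invertible_left_inverse matrix_left_invertible_ker .
  qed
  show thesis
  proof
    fix t assume t: "t \<in> S"
    show "A t *v p t = b"
      unfolding cramer[OF det[OF t]] p_def D_def ..
    have "D k differentiable (at t within S)" for k
      unfolding D_def
    proof (rule differentiable_det)
      fix i j
      show "(\<lambda>t. (\<chi> i j. if j = k then b $ i else A t $ i $ j) $ i $ j) differentiable (at t within S)"
        using A[OF t, of i j] by (cases "j = k") auto
    qed
    then have "(\<lambda>t. D k t / det (A t)) differentiable (at t within S)" for k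
      using differentiable_det[OF A[OF t]] det[OF t] by (intro differentiable_divide)
    then have comp: "(\<lambda>t. p t \<bullet> axis k 1) differentiable (at t within S)" for k
      by (simp add: p_def inner_axis)
    show "p differentiable (at t within S)"
    proof (rule differentiable_componentwise_within[THEN iffD2], rule ballI)
      fix i :: "real ^ 'n" assume "i \<in> Basis"
      then obtain k where "i = axis k 1" by (auto simp: Basis_vec_def)
      with comp[of k] show "(\<lambda>t. p t \<bullet> i) differentiable (at t within S)" by simp
    qed
  qed
qed

section \<open>Zero angular momentum\<close>

text \<open>
  Contracting the skew-symmetric matrix \<open>\<Sum> m\<^sub>a Q\<^sub>a \<and> V\<^sub>a\<close> with \<open>p\<close>. The conclusion says that
  \<open>\<Sum> m\<^sub>a Q\<^sub>a V\<^sub>a\<^sup>T\<close> is a symmetric matrix.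
\<close>

lemma wedge_sum_zero_pairing:
  fixes Q V :: "'i \<Rightarrow> real ^ 'd"
  assumes "(\<Sum>a\<in>J. m a *\<^sub>R wedge (Q a) (V a)) = 0"
  shows "(\<Sum>a\<in>J. (m a * (p \<bullet> Q a)) *\<^sub>R V a) = (\<Sum>a\<in>J. (m a * (p \<bullet> V a)) *\<^sub>R Q a)"
proof (rule vec_eq_iff[THEN iffD2], rule allI)
  fix j
  have "0 = (\<Sum>i\<in>UNIV. p $ i * (\<Sum>a\<in>J. m a *\<^sub>R wedge (Q a) (V a)) $ i $ j)"
    using assms by simp
  also have "\<dots> = (\<Sum>a\<in>J. \<Sum>i\<in>UNIV. p $ i * (m a * (Q a $ i * V a $ j - Q a $ j * V a $ i)))"
    by (simp add: wedge_def sum_distrib_left) (rule sum.swap)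
  also have "\<dots> = (\<Sum>a\<in>J. m a * (p \<bullet> Q a) * V a $ j - m a * (p \<bullet> V a) * Q a $ j)"
    by (intro sum.cong refl)
      (simp add: inner_vec_def sum_distrib_left sum_distrib_right sum_subtractf [symmetric] algebra_simps)
  finally show "(\<Sum>a\<in>J. (m a * (p \<bullet> Q a)) *\<^sub>R V a) $ j = (\<Sum>a\<in>J. (m a * (p \<bullet> V a)) *\<^sub>R Q a) $ j"
    by (simp add: sum_subtractf)
qed

section \<open>The gravitational force\<close>

text \<open>
  When \<open>\<Sum> m\<^sub>a e\<^sub>a = 0\<close> the sum over pairs is the total mass times \<open>\<Sum> m\<^sub>a e\<^sub>a\<^sup>2\<close>. This is where the
  total mass enters the length of the time interval.
\<close>

lemma sum_pairs_Lagrange: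
  fixes m e :: "nat \<Rightarrow> real"
  shows "(\<Sum>i=1..N. \<Sum>j\<in>{i<..N}. m i * m j * (e i - e j)\<^sup>2)
    = (\<Sum>a=1..N. m a) * (\<Sum>a=1..N. m a * (e a)\<^sup>2) - (\<Sum>a=1..N. m a * e a)\<^sup>2"
proof (induction N)
  case (Suc N)
  have split: "(\<Sum>a=1..Suc N. h a) = (\<Sum>a=1..N. h a) + h (Suc N)" for h :: "nat \<Rightarrow> real"
    by simp
  have "(\<Sum>i=1..Suc N. \<Sum>j\<in>{i<..Suc N}. m i * m j * (e i - e j)\<^sup>2)
    = (\<Sum>i=1..N. (\<Sum>j\<in>{i<..N}. m i * m j * (e i - e j)\<^sup>2) + m i * m (Suc N) * (e i - e (Suc N))\<^sup>2)"
  proof -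
    have "{i<..Suc N} = insert (Suc N) {i<..N}" if "i \<le> N" for i using that by auto
    then show ?thesis by (auto intro!: sum.cong)
  qed
  also have "\<dots> = (\<Sum>i=1..N. (\<Sum>j\<in>{i<..N}. m i * m j * (e i - e j)\<^sup>2))
     + m (Suc N) * ((\<Sum>i=1..N. m i * (e i)\<^sup>2) - 2 * e (Suc N) * (\<Sum>i=1..N. m i * e i)
         + (e (Suc N))\<^sup>2 * (\<Sum>i=1..N. m i))"
    unfolding sum_distrib_left sum_subtractf[symmetric] sum.distrib[symmetric]
    by (intro sum.cong refl) (simp add: power2_diff algebra_simps)
  finally show ?case
    unfolding Suc.IH split by algebra
qed simp

text \<open>
  The gradient is kept as a sum over all pairs: the factor \<open>of_bool (i = a) - of_bool (j = a)\<close>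
  is the derivative of \<open>x i - x j\<close> in the position of body \<open>a\<close>, so no sum has to be split
  according to whether \<open>a\<close> is the smaller or the larger index of a pair.
\<close>

lemma GDERIV_potential:
  fixes x :: "nat \<Rightarrow> real ^ 'd"
  assumes dist: "\<And>i j. i \<in> {1..N} \<Longrightarrow> j \<in> {1..N} \<Longrightarrow> i \<noteq> j \<Longrightarrow> x i \<noteq> x j"
  shows "GDERIV (\<lambda>y. potential G N m (x(a := y))) (x a) :>
    G *\<^sub>R (\<Sum>i=1..N. \<Sum>j\<in>{i<..N}.
      (m i * m j / dist (x i) (x j) ^ 3 * (of_bool (i = a) - of_bool (j = a))) *\<^sub>R (x i - x j))"
proof -
  have 1: "((\<lambda>y. m i * m j / dist ((x(a := y)) i) ((x(a := y)) j)) has_derivative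
      (\<lambda>h. h \<bullet> ((- m i * m j / dist (x i) (x j) ^ 3 * (of_bool (i = a) - of_bool (j = a))) *\<^sub>R (x i - x j))))
      (at (x a))" if "i \<in> {1..N}" "j \<in> {i<..N}" for i j
  proof -
    define \<kappa> :: real where "\<kappa> = of_bool (i = a) - of_bool (j = a)"
    \<comment> \<open>The difference vector is affine in \<open>y\<close> with slope \<open>\<kappa>\<close>, so one chain rule covers all cases.\<close>
    define w where "w y = (x(a := y)) i - (x(a := y)) j" for y
    have w: "w (x a) = x i - x j" "w (x a) \<noteq> 0"
      using dist[of i j] that by (auto simp: w_def)
    have dw: "(w has_derivative (\<lambda>h. \<kappa> *\<^sub>R h)) (at (x a))"
      unfolding w_def \<kappa>_def using that
      by (cases "i = a"; cases "j = a") (auto intro!: derivative_eq_intros)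
    have "((\<lambda>y. m i * m j * inverse (norm (w y))) has_derivative
      (\<lambda>h. m i * m j * - (inverse (norm (w (x a))) * ((\<kappa> *\<^sub>R h) \<bullet> sgn (w (x a))) * inverse (norm (w (x a))))))
      (at (x a))"
      using has_derivative_mult_right[OF Deriv.has_derivative_inverse
          [OF _ has_derivative_compose[OF dw has_derivative_norm]]] w(2) by auto
    moreover have "(\<lambda>y. m i * m j * inverse (norm (w y)))
        = (\<lambda>y. m i * m j / dist ((x(a := y)) i) ((x(a := y)) j))"
      by (simp only: dist_norm w_def divide_inverse)
    ultimately show ?thesis
      unfolding w(1) \<kappa>_def[symmetric]
      by (simp add: dist_norm sgn_div_norm divide_inverse power3_eq_cube mult_ac)
  qed
  show ?thesis
    unfolding gderiv_def potential_def
    by (rule derivative_eq_intros 1 refl | assumption)+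
      (auto simp: fun_eq_iff inner_sum_right sum_distrib_left sum_negf[symmetric] intro!: sum.cong)
qed


text \<open>
  Summation by parts over pairs: by action and reaction, the two bodies of a pair contribute
  opposite forces, which leaves the difference \<open>e i - e j\<close>.
\<close>

lemma newton_force_pairing:
  fixes x w :: "nat \<Rightarrow> real ^ 'd" and e :: "nat \<Rightarrow> real"
  assumes dist: "\<And>i j. i \<in> {1..N} \<Longrightarrow> j \<in> {1..N} \<Longrightarrow> i \<noteq> j \<Longrightarrow> x i \<noteq> x j"
    and newton: "\<And>a. a \<in> {1..N} \<Longrightarrow>
      GDERIV (\<lambda>y. potential G N m (x(a := y))) (x a) :> - (m a *\<^sub>R w a)"
  shows "(\<Sum>a=1..N. m a * e a * (p \<bullet> w a)) =
    - G * (\<Sum>i=1..N. \<Sum>j\<in>{i<..N}. m i * m j / dist (x i) (x j) ^ 3 * (e i - e j) * (p \<bullet> (x i - x j)))"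
proof -
  define C where "C i j = m i * m j / dist (x i) (x j) ^ 3" for i j
  have eq: "m a *\<^sub>R w a =
      - G *\<^sub>R (\<Sum>i=1..N. \<Sum>j\<in>{i<..N}. (C i j * (of_bool (i = a) - of_bool (j = a))) *\<^sub>R (x i - x j))"
    if "a \<in> {1..N}" for a
  proof -
    define D where "D = (\<Sum>i=1..N. \<Sum>j\<in>{i<..N}.
        (C i j * (of_bool (i = a) - of_bool (j = a))) *\<^sub>R (x i - x j))"
    have "GDERIV (\<lambda>y. potential G N m (x(a := y))) (x a) :> G *\<^sub>R D"
      unfolding D_def C_def by (rule GDERIV_potential; fact)
    then have "(\<lambda>h. h \<bullet> - (m a *\<^sub>R w a)) = (\<lambda>h. h \<bullet> (G *\<^sub>R D))"
      using newton[OF that] unfolding gderiv_def by (rule has_derivative_unique[rotated])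
    from fun_cong[OF this] have "- (m a *\<^sub>R w a) = G *\<^sub>R D"
      using vector_eq_ldot by blast
    then have "m a *\<^sub>R w a = - G *\<^sub>R D" by (simp add: equation_minus_iff)
    then show ?thesis unfolding D_def .
  qed
  have "(\<Sum>a=1..N. m a * e a * (p \<bullet> w a)) = (\<Sum>a=1..N. e a * (p \<bullet> (m a *\<^sub>R w a)))"
    by (simp add: mult_ac)
  also have "\<dots> = (\<Sum>a=1..N. \<Sum>i=1..N. \<Sum>j\<in>{i<..N}.
      - G * (C i j * (p \<bullet> (x i - x j)) * (e a * (of_bool (i = a) - of_bool (j = a)))))"
  proof (rule sum.cong[OF refl])
    fix a assume a: "a \<in> {1..N}"
    show "e a * (p \<bullet> (m a *\<^sub>R w a)) = (\<Sum>i=1..N. \<Sum>j\<in>{i<..N}.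
        - G * (C i j * (p \<bullet> (x i - x j)) * (e a * (of_bool (i = a) - of_bool (j = a)))))"
      unfolding eq[OF a] inner_scaleR_right inner_sum_right sum_distrib_left
      by (intro sum.cong refl) (simp only: mult_ac)
  qed
  also have "\<dots> = (\<Sum>i=1..N. \<Sum>j\<in>{i<..N}. \<Sum>a=1..N.
      - G * (C i j * (p \<bullet> (x i - x j)) * (e a * (of_bool (i = a) - of_bool (j = a)))))"
    by (subst sum.swap) (rule sum.cong[OF refl], rule sum.swap)
  also have "\<dots> = (\<Sum>i=1..N. \<Sum>j\<in>{i<..N}. - G * (C i j * (p \<bullet> (x i - x j)) * (e i - e j)))"
  proof (intro sum.cong refl)
    fix i j assume ij: "i \<in> {1..N}" "j \<in> {i<..N}"
    have "(\<Sum>a=1..N. e a * (of_bool (i = a) - of_bool (j = a))) = e i - e j"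
    proof -
      have "(\<Sum>a=1..N. e a * of_bool (k = a)) = (\<Sum>a=1..N. if k = a then e a else 0)" for k
        by (intro sum.cong) auto
      then show ?thesis using ij by (simp add: right_diff_distrib sum_subtractf)
    qed
    then show "(\<Sum>a=1..N. - G * (C i j * (p \<bullet> (x i - x j)) * (e a * (of_bool (i = a) - of_bool (j = a)))))
        = - G * (C i j * (p \<bullet> (x i - x j)) * (e i - e j))"
      by (simp only: flip: sum_distrib_left)
  qed
  finally show ?thesis
    unfolding C_def sum_distrib_left by (simp only: mult_ac)
qed

text \<open>
  For \<open>e a = p \<bullet> (x a - z)\<close> each pair contributes \<open>- G m\<^sub>i m\<^sub>j (e\<^sub>i - e\<^sub>j)\<^sup>2 / r\<^sub>i\<^sub>j\<^sup>3\<close>, which only grows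
  when \<open>r\<^sub>i\<^sub>j\<close> is replaced by its upper bound \<open>c\<close>. The sum over pairs is then evaluated by
  \<open>sum_pairs_Lagrange\<close>.
\<close>

lemma newton_force_bound:
  fixes x w :: "nat \<Rightarrow> real ^ 'd"
  assumes dist: "\<And>i j. i \<in> {1..N} \<Longrightarrow> j \<in> {1..N} \<Longrightarrow> i \<noteq> j \<Longrightarrow> x i \<noteq> x j"
    and newton: "\<And>a. a \<in> {1..N} \<Longrightarrow>
      GDERIV (\<lambda>y. potential G N m (x(a := y))) (x a) :> - (m a *\<^sub>R w a)"
    and "G > 0" and m: "\<And>a. a \<in> {1..N} \<Longrightarrow> m a > 0"
    and c: "\<And>i j. i \<in> {1..N} \<Longrightarrow> j \<in> {1..N} \<Longrightarrow> i \<noteq> j \<Longrightarrow> dist (x i) (x j) \<le> c"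
    and cm: "(\<Sum>a=1..N. m a *\<^sub>R (x a - z)) = 0"
  shows "(\<Sum>a=1..N. m a * (p \<bullet> (x a - z)) * (p \<bullet> w a))
    \<le> - (G * total_mass N m / c ^ 3) * (\<Sum>a=1..N. m a * (p \<bullet> (x a - z))\<^sup>2)"
proof -
  define e where "e a = p \<bullet> (x a - z)" for a
  have e: "p \<bullet> (x i - x j) = e i - e j" for i j
    by (simp add: e_def inner_diff_right)
  have "(\<Sum>a=1..N. m a * e a) = p \<bullet> (\<Sum>a=1..N. m a *\<^sub>R (x a - z))"
    by (simp add: e_def inner_sum_right)
  then have e0: "(\<Sum>a=1..N. m a * e a) = 0" using cm by simp
  have "(\<Sum>i=1..N. \<Sum>j\<in>{i<..N}. m i * m j / c ^ 3 * (e i - e j)\<^sup>2)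
      \<le> (\<Sum>i=1..N. \<Sum>j\<in>{i<..N}. m i * m j / dist (x i) (x j) ^ 3 * (e i - e j)\<^sup>2)"
  proof (intro sum_mono mult_right_mono divide_left_mono)
    fix i j assume ij: "i \<in> {1..N}" "j \<in> {i<..N}"
    then have ne: "x i \<noteq> x j" and le: "dist (x i) (x j) \<le> c" using dist[of i j] c[of i j] by auto
    show "dist (x i) (x j) ^ 3 \<le> c ^ 3" using le by (intro power_mono) auto
    show "0 \<le> m i * m j" using m[of i] m[of j] ij by auto
    have "c > 0" using ne le by (smt (verit) zero_less_dist_iff)
    then show "0 < c ^ 3 * dist (x i) (x j) ^ 3" using ne by simp
  qed simp
  moreover have "(\<Sum>i=1..N. \<Sum>j\<in>{i<..N}. m i * m j / c ^ 3 * (e i - e j)\<^sup>2)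
      = total_mass N m / c ^ 3 * (\<Sum>a=1..N. m a * (e a)\<^sup>2)"
  proof -
    have "(\<Sum>i=1..N. \<Sum>j\<in>{i<..N}. m i * m j / c ^ 3 * (e i - e j)\<^sup>2)
        = (\<Sum>i=1..N. \<Sum>j\<in>{i<..N}. m i * m j * (e i - e j)\<^sup>2) / c ^ 3"
      unfolding sum_divide_distrib by (simp only: times_divide_eq_left)
    then show ?thesis unfolding sum_pairs_Lagrange e0 total_mass_def by simp
  qed
  ultimately have "G * (total_mass N m / c ^ 3 * (\<Sum>a=1..N. m a * (e a)\<^sup>2)) \<le>
      G * (\<Sum>i=1..N. \<Sum>j\<in>{i<..N}. m i * m j / dist (x i) (x j) ^ 3 * (e i - e j)\<^sup>2)"
    using \<open>G > 0\<close> by (intro mult_left_mono) auto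
  moreover have "(\<Sum>a=1..N. m a * e a * (p \<bullet> w a)) = - G *
      (\<Sum>i=1..N. \<Sum>j\<in>{i<..N}. m i * m j / dist (x i) (x j) ^ 3 * (e i - e j)\<^sup>2)"
  proof -
    have "(\<Sum>a=1..N. m a * e a * (p \<bullet> w a)) = - G * (\<Sum>i=1..N. \<Sum>j\<in>{i<..N}.
        m i * m j / dist (x i) (x j) ^ 3 * (e i - e j) * (p \<bullet> (x i - x j)))"
      by (rule newton_force_pairing; fact)
    then show ?thesis by (simp only: e power2_eq_square mult.assoc)
  qed
  ultimately show ?thesis unfolding e_def[symmetric] by simp
qed

section \<open>Nondegenerate configurations\<close>

text \<open>
  The two linear-algebra consequences of nondegeneracy: the points affinely span the space, hence
  the inertia tensor is definite; and \<open>d + 1\<close> distinct spanning points are affinely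
  independent, hence weights with sum zero are determined by the combination of positions
  that they produce.
\<close>

lemma nondegenerate_frame:
  fixes x :: "nat \<Rightarrow> real ^ 'd"
  assumes N: "N = CARD('d) + 1"
    and nondeg: "\<And>H. affine H \<Longrightarrow> aff_dim H = int CARD('d) - 1 \<Longrightarrow> \<exists>a\<in>{1..N}. x a \<notin> H"
    and inj: "inj_on x {1..N}"
  shows "(\<And>a. a \<in> {1..N} \<Longrightarrow> p \<bullet> (x a - z) = 0) \<Longrightarrow> p = 0"
    and "(\<Sum>a=1..N. \<xi> a) = 0 \<Longrightarrow> (\<Sum>a=1..N. \<xi> a *\<^sub>R (x a - z)) = 0 \<Longrightarrow> a \<in> {1..N} \<Longrightarrow> \<xi> a = 0"
proof -
  have hyper: "\<exists>a\<in>{1..N}. p \<bullet> x a \<noteq> b" if "p \<noteq> 0" for p b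
    using nondeg[of "{y. p \<bullet> y = b}"] that by (auto simp: affine_hyperplane of_nat_diff Suc_leI)
  show "p = 0" if "\<And>a. a \<in> {1..N} \<Longrightarrow> p \<bullet> (x a - z) = 0"
    using hyper[of p "p \<bullet> z"] that by (auto simp: inner_diff_right)
  have "aff_dim (x ` {1..N}) = int CARD('d)"
  proof (rule ccontr)
    assume "\<not> ?thesis"
    then have "aff_dim (x ` {1..N}) < DIM(real ^ 'd)"
      using aff_dim_le_DIM[of "x ` {1..N}"] by simp
    then obtain p b where "p \<noteq> 0" "x ` {1..N} \<subseteq> {y. p \<bullet> y = b}"
      by (rule aff_lowdim_subset_hyperplane)
    with hyper[of p b] show False by auto
  qed
  then have indep: "\<not> affine_dependent (x ` {1..N})"
    using inj by (simp add: affine_independent_iff_card card_image N)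
  assume \<xi>: "(\<Sum>a=1..N. \<xi> a) = 0" "(\<Sum>a=1..N. \<xi> a *\<^sub>R (x a - z)) = 0" and a: "a \<in> {1..N}"
  define U where "U = \<xi> \<circ> the_inv_into {1..N} x"
  have U: "U (x b) = \<xi> b" if "b \<in> {1..N}" for b
    using that inj by (simp add: U_def the_inv_into_f_f)
  have "sum U (x ` {1..N}) = 0"
    using \<xi>(1) U inj by (simp add: sum.reindex)
  moreover have "(\<Sum>y\<in>x ` {1..N}. U y *\<^sub>R y) = 0"
    using \<xi> U inj by (simp add: sum.reindex scaleR_diff_right sum_subtractf flip: scaleR_sum_left)
  ultimately show "\<xi> a = 0"
    using indep a U[OF a] by (auto simp: affine_dependent_explicit_finite)
qed

section \<open>A positive barrier function\<close>

text \<open>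
  The function is \<open>\<phi> = 1 / \<bar>X\<^sup>-\<^sup>1 x\<bar>\<close> for an arbitrary fixed \<open>x \<noteq> 0\<close>, in the notation of the
  introduction. The kinetic term \<open>- 3 K\<close>, produced by zero angular
  momentum, exactly absorbs the Cauchy-Schwarz bound for the convexity term \<open>3 g\<^sup>2 / f\<^bsup>5/2\<^esup>\<close>, so that
  only the force remains.
\<close>

lemma barrier_exists:
  fixes Q V W :: "real \<Rightarrow> 'i \<Rightarrow> real ^ 'd" and m :: "'i \<Rightarrow> real" and k :: real
  assumes "finite J" and m: "\<And>a. a \<in> J \<Longrightarrow> m a > 0"
    and lim: "\<And>t. t \<in> T \<Longrightarrow> at t within T \<noteq> bot"
    and dQ: "\<And>t a. t \<in> T \<Longrightarrow> a \<in> J \<Longrightarrow> ((\<lambda>t. Q t a) has_vector_derivative V t a) (at t within T)"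
    and dV: "\<And>t a. t \<in> T \<Longrightarrow> a \<in> J \<Longrightarrow> ((\<lambda>t. V t a) has_vector_derivative W t a) (at t within T)"
    and cm: "\<And>t. t \<in> T \<Longrightarrow> (\<Sum>a\<in>J. m a *\<^sub>R Q t a) = 0"
    and cm': "\<And>t. t \<in> T \<Longrightarrow> (\<Sum>a\<in>J. m a *\<^sub>R V t a) = 0"
    and mom: "\<And>t. t \<in> T \<Longrightarrow> (\<Sum>a\<in>J. m a *\<^sub>R wedge (Q t a) (V t a)) = 0"
    and span: "\<And>t p. t \<in> T \<Longrightarrow> (\<And>a. a \<in> J \<Longrightarrow> p \<bullet> Q t a = 0) \<Longrightarrow> p = 0"
    and indep: "\<And>t \<xi> a. t \<in> T \<Longrightarrow> (\<Sum>a\<in>J. \<xi> a) = 0 \<Longrightarrow> (\<Sum>a\<in>J. \<xi> a *\<^sub>R Q t a) = 0 \<Longrightarrow> a \<in> J \<Longrightarrow> \<xi> a = 0"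
    and force: "\<And>t p. t \<in> T \<Longrightarrow> (\<Sum>a\<in>J. m a * (p \<bullet> Q t a) * (p \<bullet> W t a)) \<le> - k * (\<Sum>a\<in>J. m a * (p \<bullet> Q t a)\<^sup>2)"
  obtains \<phi> \<phi>' \<phi>'' :: "real \<Rightarrow> real"
  where "\<And>t. t \<in> T \<Longrightarrow> \<phi> t > 0"
    and "\<And>t. t \<in> T \<Longrightarrow> (\<phi> has_real_derivative \<phi>' t) (at t within T)"
    and "\<And>t. t \<in> T \<Longrightarrow> (\<phi>' has_real_derivative \<phi>'' t) (at t within T)"
    and "\<And>t. t \<in> T \<Longrightarrow> \<phi>'' t \<le> - k * \<phi> t"
proof -
  define B :: "real \<Rightarrow> real ^ 'd ^ 'd" where
    "B t = (\<chi> i j. \<Sum>a\<in>J. m a * Q t a $ i * Q t a $ j)" for t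
  have B: "B t *v p = (\<Sum>a\<in>J. (m a * (p \<bullet> Q t a)) *\<^sub>R Q t a)" for t p
    unfolding vec_eq_iff
  proof
    fix i
    have "(B t *v p) $ i = (\<Sum>j\<in>UNIV. \<Sum>a\<in>J. m a * Q t a $ i * Q t a $ j * p $ j)"
      by (simp add: B_def matrix_vector_mult_def sum_distrib_right)
    also have "\<dots> = (\<Sum>a\<in>J. \<Sum>j\<in>UNIV. m a * Q t a $ i * Q t a $ j * p $ j)"
      by (rule sum.swap)
    also have "\<dots> = (\<Sum>a\<in>J. (m a * (p \<bullet> Q t a)) *\<^sub>R Q t a) $ i"
      by (simp add: inner_vec_def sum_distrib_left sum_distrib_right mult_ac)
    finally show "(B t *v p) $ i = (\<Sum>a\<in>J. (m a * (p \<bullet> Q t a)) *\<^sub>R Q t a) $ i" .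
  qed
  have pBp: "p \<bullet> (B t *v p) = (\<Sum>a\<in>J. m a * (p \<bullet> Q t a)\<^sup>2)" for t p
    by (simp add: B inner_sum_right power2_eq_square mult_ac)
  have pos: "p = 0" if t: "t \<in> T" and 0: "(\<Sum>a\<in>J. m a * (p \<bullet> Q t a)\<^sup>2) = 0" for t p
  proof (rule span[OF t])
    fix a assume "a \<in> J"
    then have "m a * (p \<bullet> Q t a)\<^sup>2 = 0"
      using 0 m \<open>finite J\<close> by (subst (asm) sum_nonneg_eq_0_iff) (auto simp: less_imp_le)
    then show "p \<bullet> Q t a = 0" using m[OF \<open>a \<in> J\<close>] by simp
  qed
  obtain x :: "real ^ 'd" where "x \<noteq> 0"
    using axis_eq_0_iff[of undefined "1::real"] by blast
  obtain p where Bp: "\<And>t. t \<in> T \<Longrightarrow> B t *v p t = x"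
    and p: "\<And>t. t \<in> T \<Longrightarrow> p differentiable (at t within T)"
  proof (rule differentiable_linear_system[of T B x])
    fix t i j assume t: "t \<in> T"
    have "(\<lambda>t. Q t a $ i) differentiable (at t within T)" if "a \<in> J" for a i
      using bounded_linear.has_vector_derivative[OF bounded_linear_vec_nth dQ[OF t that]]
      by (rule differentiableI_vector)
    then show "(\<lambda>t. B t $ i $ j) differentiable (at t within T)"
      using \<open>finite J\<close> by (simp add: B_def)
  next
    fix t p assume "t \<in> T" "B t *v p = 0"
    then show "p = 0" using pos[of t p] pBp[of p t] by simp
  qed blast
  define p' where "p' t = vector_derivative p (at t within T)" for t
  have dp: "(p has_vector_derivative p' t) (at t within T)" if "t \<in> T" for t
    using p[OF that] unfolding p'_def vector_derivative_works .
  have dpQ: "((\<lambda>t. p t \<bullet> Q t a) has_real_derivative p' t \<bullet> Q t a + p t \<bullet> V t a) (at t within T)"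
    if "t \<in> T" "a \<in> J" for t a
    using bounded_bilinear.has_vector_derivative[OF bounded_bilinear_inner dp[OF that(1)] dQ[OF that]]
    by (simp add: has_real_derivative_iff_has_vector_derivative add.commute)
  have dpV: "((\<lambda>t. p t \<bullet> V t a) has_real_derivative p' t \<bullet> V t a + p t \<bullet> W t a) (at t within T)"
    if "t \<in> T" "a \<in> J" for t a
    using bounded_bilinear.has_vector_derivative[OF bounded_bilinear_inner dp[OF that(1)] dV[OF that]]
    by (simp add: has_real_derivative_iff_has_vector_derivative add.commute)
  \<comment> \<open>The derivative of the weights \<open>m\<^sub>a (p \<bullet> Q\<^sub>a)\<close> and the weights \<open>- m\<^sub>a (p \<bullet> V\<^sub>a)\<close> both have sum zero
     and produce the same combination of positions, so affine independence identifies them.\<close>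
  have p'Q: "p' t \<bullet> Q t a = - 2 * (p t \<bullet> V t a)" if t: "t \<in> T" and a: "a \<in> J" for t a
  proof -
    define \<xi> where "\<xi> a = m a * (p' t \<bullet> Q t a + 2 * (p t \<bullet> V t a))" for a
    have "(\<Sum>a\<in>J. \<xi> a) = p' t \<bullet> (\<Sum>a\<in>J. m a *\<^sub>R Q t a) + 2 * (p t \<bullet> (\<Sum>a\<in>J. m a *\<^sub>R V t a))"
      by (simp add: \<xi>_def inner_sum_right sum_distrib_left sum.distrib algebra_simps)
    then have 1: "(\<Sum>a\<in>J. \<xi> a) = 0" using cm[OF t] cm'[OF t] by simp
    \<comment> \<open>\<open>?D\<close> is the derivative of the constant \<open>B t *v p t = x\<close>.\<close>
    let ?D = "\<Sum>a\<in>J. (m a * (p t \<bullet> Q t a)) *\<^sub>R V t a + (m a * (p' t \<bullet> Q t a + p t \<bullet> V t a)) *\<^sub>R Q t a"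
    have "((\<lambda>t. \<Sum>a\<in>J. (m a * (p t \<bullet> Q t a)) *\<^sub>R Q t a) has_vector_derivative ?D) (at t within T)"
      using t by (intro has_vector_derivative_sum has_vector_derivative_scaleR DERIV_cmult dpQ dQ)
    moreover have "((\<lambda>t. \<Sum>a\<in>J. (m a * (p t \<bullet> Q t a)) *\<^sub>R Q t a) has_vector_derivative 0) (at t within T)"
      by (rule has_vector_derivative_transform[OF t _ has_vector_derivative_const[of x]])
        (simp add: Bp flip: B)
    ultimately have "?D = 0"
      using vector_derivative_unique_within[OF lim[OF t]] by blast
    moreover have "(\<Sum>a\<in>J. \<xi> a *\<^sub>R Q t a) = (\<Sum>a\<in>J. (m a * (p t \<bullet> V t a)) *\<^sub>R Q t a)
        + (\<Sum>a\<in>J. (m a * (p' t \<bullet> Q t a + p t \<bullet> V t a)) *\<^sub>R Q t a)"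
      unfolding sum.distrib[symmetric] scaleR_left_distrib[symmetric]
      by (intro sum.cong refl arg_cong2[where f = scaleR]) (simp add: \<xi>_def algebra_simps)
    ultimately have 2: "(\<Sum>a\<in>J. \<xi> a *\<^sub>R Q t a) = 0"
      using wedge_sum_zero_pairing[OF mom[OF t], of "p t"] by (simp add: sum.distrib)
    from indep[OF t 1 2 a] m[OF a] show ?thesis by (simp add: \<xi>_def)
  qed
  define f where "f t = (\<Sum>a\<in>J. m a * (p t \<bullet> Q t a)\<^sup>2)" for t
  define g where "g t = (\<Sum>a\<in>J. m a * (p t \<bullet> Q t a) * (p t \<bullet> V t a))" for t
  define K where "K t = (\<Sum>a\<in>J. m a * (p t \<bullet> V t a)\<^sup>2)" for t
  define F where "F t = (\<Sum>a\<in>J. m a * (p t \<bullet> Q t a) * (p t \<bullet> W t a))" for t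
  have fpos: "f t > 0" if t: "t \<in> T" for t
  proof -
    have "f t \<ge> 0" unfolding f_def using m by (auto intro!: sum_nonneg simp: less_imp_le)
    moreover have "f t \<noteq> 0"
      using pos[OF t, of "p t"] Bp[OF t] \<open>x \<noteq> 0\<close> by (auto simp: f_def)
    ultimately show ?thesis by simp
  qed
  have df: "(f has_real_derivative - 2 * g t) (at t within T)" if t: "t \<in> T" for t
    unfolding f_def g_def
    by (rule derivative_eq_intros dpQ[OF t] refl | assumption)+
      (simp add: p'Q[OF t] sum_distrib_left sum_negf[symmetric] algebra_simps)
  have dg: "(g has_real_derivative F t - 3 * K t) (at t within T)" if t: "t \<in> T" for t
  proof -
    \<comment> \<open>The symmetry trades \<open>p' \<bullet> V\<^sub>a\<close>, which is not controlled, for \<open>p' \<bullet> Q\<^sub>a = - 2 (p \<bullet> V\<^sub>a)\<close>.\<close>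
    have "p' t \<bullet> (\<Sum>a\<in>J. (m a * (p t \<bullet> Q t a)) *\<^sub>R V t a) = p' t \<bullet> (\<Sum>a\<in>J. (m a * (p t \<bullet> V t a)) *\<^sub>R Q t a)"
      using wedge_sum_zero_pairing[OF mom[OF t], of "p t"] by simp
    also have "\<dots> = - 2 * K t"
      by (simp add: K_def inner_sum_right p'Q[OF t] sum_distrib_left power2_eq_square algebra_simps
          sum_negf[symmetric])
    finally have *: "(\<Sum>a\<in>J. m a * (p t \<bullet> Q t a) * (p' t \<bullet> V t a)) = - 2 * K t"
      by (simp add: inner_sum_right)
    have "(g has_real_derivative (\<Sum>a\<in>J. m a * (p' t \<bullet> Q t a + p t \<bullet> V t a) * (p t \<bullet> V t a)
          + (p' t \<bullet> V t a + p t \<bullet> W t a) * (m a * (p t \<bullet> Q t a)))) (at t within T)"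
      unfolding g_def using t by (intro DERIV_sum DERIV_mult DERIV_cmult dpQ dpV)
    moreover have "(\<Sum>a\<in>J. m a * (p' t \<bullet> Q t a + p t \<bullet> V t a) * (p t \<bullet> V t a)
          + (p' t \<bullet> V t a + p t \<bullet> W t a) * (m a * (p t \<bullet> Q t a)))
        = - K t + (\<Sum>a\<in>J. m a * (p t \<bullet> Q t a) * (p' t \<bullet> V t a)) + F t"
      unfolding K_def F_def sum_negf[symmetric] sum.distrib[symmetric]
      by (intro sum.cong refl) (simp add: p'Q[OF t] power2_eq_square algebra_simps)
    ultimately show ?thesis unfolding * by simp
  qed
  have CS: "(g t)\<^sup>2 \<le> f t * K t" for t
  proof -
    have "g t = (\<Sum>a\<in>J. (sqrt (m a) * (p t \<bullet> Q t a)) * (sqrt (m a) * (p t \<bullet> V t a)))"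
      unfolding g_def using m by (intro sum.cong refl) (simp add: algebra_simps less_imp_le)
    moreover have "f t = (\<Sum>a\<in>J. (sqrt (m a) * (p t \<bullet> Q t a))\<^sup>2)"
      "K t = (\<Sum>a\<in>J. (sqrt (m a) * (p t \<bullet> V t a))\<^sup>2)"
      unfolding f_def K_def using m by (auto intro!: sum.cong simp: power_mult_distrib less_imp_le)
    ultimately show ?thesis using Cauchy_Schwarz_ineq_sum by metis
  qed
  show thesis
  proof
    fix t assume t: "t \<in> T"
    note f = fpos[OF t]
    define s where "s = sqrt (f t)"
    have s: "s > 0" "s\<^sup>2 = f t" using f by (auto simp: s_def less_imp_le)
    show "1 / sqrt (f t) > 0" using f by simp
    show "((\<lambda>t. 1 / sqrt (f t)) has_real_derivative g t / sqrt (f t) ^ 3) (at t within T)"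
      using f by (auto intro!: derivative_eq_intros df[OF t] simp: field_simps power3_eq_cube)
    have "((\<lambda>t. sqrt (f t)) has_real_derivative - g t / s) (at t within T)"
      using f by (auto intro!: derivative_eq_intros df[OF t] simp: s_def field_simps)
    from DERIV_divide[OF dg[OF t] DERIV_power[OF this, of 3]]
    have "((\<lambda>t. g t / sqrt (f t) ^ 3) has_real_derivative
        ((F t - 3 * K t) * s ^ 3 - g t * (3 * (- g t / s * s ^ 2))) / (s ^ 3 * s ^ 3)) (at t within T)"
      using s(1) by (simp add: s_def[symmetric])
    moreover have "((F t - 3 * K t) * s ^ 3 - g t * (3 * (- g t / s * s ^ 2))) / (s ^ 3 * s ^ 3)
        = (F t - 3 * K t) / s ^ 3 + 3 * (g t)\<^sup>2 / s ^ 5"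
      using s(1) by (simp add: divide_simps) (simp add: algebra_simps eval_nat_numeral)
    ultimately show "((\<lambda>t. g t / sqrt (f t) ^ 3) has_real_derivative
        (F t - 3 * K t) / sqrt (f t) ^ 3 + 3 * (g t)\<^sup>2 / sqrt (f t) ^ 5) (at t within T)"
      by (simp only: s_def)
    have "(F t - 3 * K t) / s ^ 3 + 3 * (g t)\<^sup>2 / s ^ 5 \<le> (- k * s\<^sup>2 - 3 * K t) / s ^ 3 + 3 * (s\<^sup>2 * K t) / s ^ 5"
      using force[OF t, of "p t"] CS[of t] s
      by (intro add_mono divide_right_mono mult_left_mono) (auto simp: F_def f_def)
    also have "\<dots> = - k * (1 / s)"
      using s(1) by (simp add: divide_simps) (simp add: algebra_simps eval_nat_numeral)
    finally show "(F t - 3 * K t) / sqrt (f t) ^ 3 + 3 * (g t)\<^sup>2 / sqrt (f t) ^ 5 \<le> - k * (1 / sqrt (f t))"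
      by (simp only: s_def)
  qed
qed


section \<open>Degeneration instants\<close>

theorem theorem1p2:
  fixes G c :: real and N :: nat and m :: "nat \<Rightarrow> real" and I :: "real set"
    and q :: "real \<Rightarrow> nat \<Rightarrow> real ^ 'd"
  assumes "N = CARD('d) + 1"
    and "G > 0"
    and "\<forall>a\<in>{1..N}. m a > 0"
    and "is_interval I"
    and "newton_solution G N m I q"
    and "\<forall>t\<in>I. angular_momentum N m I q t = 0"
    and "c > 0"
    and "\<forall>t\<in>I. \<forall>a\<in>{1..N}. \<forall>b\<in>{1..N}. a \<noteq> b \<longrightarrow> dist (q t a) (q t b) \<le> c"
  shows "\<forall>u v. v - u = pi * sqrt (c ^ 3 / (G * total_mass N m)) \<and> {u..v} \<subseteq> I \<longrightarrow>
           (\<exists>t\<in>{u..v}. degeneration_instant N q t)"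
proof (intro allI impI, rule ccontr)
  fix u v
  assume uv: "v - u = pi * sqrt (c ^ 3 / (G * total_mass N m)) \<and> {u..v} \<subseteq> I"
    and nondeg: "\<not> (\<exists>t\<in>{u..v}. degeneration_instant N q t)"
  define M where "M = total_mass N m"
  have m: "m a > 0" if "a \<in> {1..N}" for a using assms(3) that by blast
  have "M > 0" unfolding M_def total_mass_def using m assms(1) by (intro sum_pos) auto
  define \<omega> where "\<omega> = sqrt (G * M / c ^ 3)"
  have k: "G * M / c ^ 3 > 0" using \<open>G > 0\<close> \<open>M > 0\<close> \<open>c > 0\<close> by simp
  then have \<omega>: "\<omega> > 0" "\<omega>\<^sup>2 = G * M / c ^ 3" by (auto simp: \<omega>_def)
  have len: "v - u = pi / \<omega>"
    using uv by (simp add: \<omega>_def M_def real_sqrt_divide)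
  moreover have "pi / \<omega> > 0" using \<omega>(1) by simp
  ultimately have "u < v" by linarith
  have lim: "at t within {u..v} \<noteq> bot" if "t \<in> {u..v}" for t
    using that \<open>u < v\<close> by (simp add: trivial_limit_within islimpt_Icc)
  have limI: "at t within I \<noteq> bot" if "t \<in> {u..v}" for t
    using lim[OF that] uv by (metis at_le bot.extremum_uniqueI)
  have sol: "q t a \<noteq> q t b" if "t \<in> I" "a \<in> {1..N}" "b \<in> {1..N}" "a \<noteq> b" for t a b
    using assms(5) that unfolding newton_solution_def by fastforce
  have dq: "((\<lambda>s. q s a) has_vector_derivative velocity I q t a) (at t within I)"
    and dv: "((\<lambda>s. velocity I q s a) has_vector_derivative acceleration I q t a) (at t within I)"
    and newton: "GDERIV (\<lambda>y. potential G N m ((q t)(a := y))) (q t a) :> - (m a *\<^sub>R acceleration I q t a)"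
    if "t \<in> I" "a \<in> {1..N}" for t a
    using assms(5) that unfolding newton_solution_def velocity_def acceleration_def
    by (auto simp: vector_derivative_works)
  define cm where "cm x = center_of_mass N m x" for x :: "nat \<Rightarrow> real ^ 'd"
  have cm_eq: "cm x = (1 / M) *\<^sub>R (\<Sum>a=1..N. m a *\<^sub>R x a)" for x
    by (simp add: cm_def center_of_mass_def M_def)
  have cm0: "(\<Sum>a=1..N. m a *\<^sub>R (x a - cm x)) = 0" for x
  proof -
    have "(\<Sum>a=1..N. m a *\<^sub>R (x a - cm x)) = (\<Sum>a=1..N. m a *\<^sub>R x a) - M *\<^sub>R cm x"
      by (simp only: scaleR_diff_right sum_subtractf scaleR_sum_left M_def total_mass_def)
    then show ?thesis using \<open>M > 0\<close> by (simp add: cm_eq)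
  qed
  have dcm: "((\<lambda>s. cm (x s)) has_vector_derivative cm y) (at t within T)"
    if "\<And>a. a \<in> {1..N} \<Longrightarrow> ((\<lambda>s. x s a) has_vector_derivative y a) (at t within T)" for x y t T
    unfolding cm_eq
    by (intro bounded_linear.has_vector_derivative[OF bounded_linear_scaleR_right]
        has_vector_derivative_sum that)
  define Q where "Q t a = q t a - cm (q t)" for t a
  define V where "V t a = velocity I q t a - cm (velocity I q t)" for t a
  define W where "W t a = acceleration I q t a - cm (acceleration I q t)" for t a
  obtain \<phi> \<phi>' \<phi>'' :: "real \<Rightarrow> real"
    where \<phi>: "\<And>t. t \<in> {u..v} \<Longrightarrow> \<phi> t > 0"
      "\<And>t. t \<in> {u..v} \<Longrightarrow> (\<phi> has_real_derivative \<phi>' t) (at t within {u..v})"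
      "\<And>t. t \<in> {u..v} \<Longrightarrow> (\<phi>' has_real_derivative \<phi>'' t) (at t within {u..v})"
      "\<And>t. t \<in> {u..v} \<Longrightarrow> \<phi>'' t \<le> - (G * M / c ^ 3) * \<phi> t"
  proof (rule barrier_exists[of "{1..N}" m "{u..v}" Q V W "G * M / c ^ 3"])
    fix t assume t: "t \<in> {u..v}"
    then have tI: "t \<in> I" using uv by blast
    show "(\<Sum>a=1..N. m a *\<^sub>R Q t a) = 0" unfolding Q_def by (rule cm0)
    show "(\<Sum>a=1..N. m a *\<^sub>R V t a) = 0" unfolding V_def by (rule cm0)
    have dcmq: "vector_derivative (\<lambda>s. cm (q s)) (at t within I) = cm (velocity I q t)"
      by (rule vector_derivative_within[OF limI[OF t]]) (rule dcm[OF dq[OF tI]])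
    show "(\<Sum>a=1..N. m a *\<^sub>R wedge (Q t a) (V t a)) = 0"
      using bspec[OF assms(6) tI] unfolding angular_momentum_def cm_def[symmetric] dcmq Q_def V_def .
    have nd: "\<exists>a\<in>{1..N}. q t a \<notin> H" if "affine H" "aff_dim H = int CARD('d) - 1" for H
      using nondeg t that unfolding degeneration_instant_def by blast
    have inj: "inj_on (q t) {1..N}"
      using sol[OF tI] by (meson inj_onI)
    show "p = 0" if "\<And>a. a \<in> {1..N} \<Longrightarrow> p \<bullet> Q t a = 0" for p
      using nondegenerate_frame(1)[OF assms(1) nd inj] that unfolding Q_def by blast
    show "\<xi> a = 0" if "(\<Sum>a=1..N. \<xi> a) = 0" "(\<Sum>a=1..N. \<xi> a *\<^sub>R Q t a) = 0" "a \<in> {1..N}" for \<xi> a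
      using nondegenerate_frame(2)[OF assms(1) nd inj] that unfolding Q_def by blast
    fix p
    \<comment> \<open>The acceleration of the center of mass drops out because the \<open>Q\<^sub>a\<close> are centered.\<close>
    have "(\<Sum>a=1..N. m a * (p \<bullet> Q t a) * (p \<bullet> W t a))
        = (\<Sum>a=1..N. m a * (p \<bullet> Q t a) * (p \<bullet> acceleration I q t a))
          - (p \<bullet> (\<Sum>a=1..N. m a *\<^sub>R Q t a)) * (p \<bullet> cm (acceleration I q t))"
      unfolding inner_sum_right sum_distrib_right sum_subtractf[symmetric]
      by (intro sum.cong refl) (simp add: W_def inner_diff_right algebra_simps)
    also have "\<dots> = (\<Sum>a=1..N. m a * (p \<bullet> Q t a) * (p \<bullet> acceleration I q t a))"
      unfolding Q_def cm0 by simp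
    also have "\<dots> \<le> - (G * M / c ^ 3) * (\<Sum>a=1..N. m a * (p \<bullet> Q t a)\<^sup>2)"
      unfolding Q_def M_def
      using assms(8) tI m
      by (intro newton_force_bound sol[OF tI] newton[OF tI] cm0 \<open>G > 0\<close>) blast+
    finally show "(\<Sum>a=1..N. m a * (p \<bullet> Q t a) * (p \<bullet> W t a))
      \<le> - (G * M / c ^ 3) * (\<Sum>a=1..N. m a * (p \<bullet> Q t a)\<^sup>2)" .
  next
    fix t a assume t: "t \<in> {u..v}" and a: "a \<in> {1..N}"
    then have tI: "t \<in> I" using uv by blast
    have sub: "{u..v} \<subseteq> I" using uv by blast
    show "((\<lambda>t. Q t a) has_vector_derivative V t a) (at t within {u..v})"
      unfolding Q_def V_def
      by (intro has_vector_derivative_diff dcm has_vector_derivative_within_subset[OF dq sub] tI a)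
    show "((\<lambda>t. V t a) has_vector_derivative W t a) (at t within {u..v})"
      unfolding V_def W_def
      by (intro has_vector_derivative_diff dcm has_vector_derivative_within_subset[OF dv sub] tI a)
  qed (use m lim in auto)
  have "\<phi> u + \<phi> v \<le> 0"
    using Sturm_half_period[OF \<omega>(1) len, of \<phi> \<phi>' \<phi>''] \<phi> \<omega>(2) by simp
  moreover have "\<phi> u > 0" "\<phi> v > 0" using \<phi>(1) \<open>u < v\<close> by auto
  ultimately show False by simp
qed

end
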